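(* Let $\lambda$ be a partition of $n$. Let $\mathcal S^{\rm Y}(V_\lambda)^*$ denote the order dual of the lattice $\mathcal S^{\rm Y}(V_\lambda)$ of subspaces of $V_\lambda$ invariant with respect to Young subgroups. Then the map $\phi:\Pi_n\to\mathcal S^{\rm Y}(V_\lambda)^*$, $\phi(\alpha)=V_\lambda^{\mathfrak S_\alpha}$, is a join homomorphism of lattices, i.e. for all $\alpha,\beta\in\Pi_n$ the element $\phi(\alpha\vee\beta)$ is the join of $\phi(\alpha)$ and $\phi(\beta)$ in $\mathcal S^{\rm Y}(V_\lambda)^*$.
   Context: $\mathfrak S_n$ is the symmetric group on $[n]=\{1,\dots,n\}$; $\pi_\lambda$ is its irreducible complex representation with Young diagram $\lambda$ (so $\pi_{(n)}$ is trivial), realized in $V_\lambda$. $\Pi_n$ is the lattice of set partitions of $[n]$ ordered by refinement (finer partitions are smaller; the minimum is the partition into singletons). For $\alpha\in\Pi_n$, $\mathfrak S_\alpha\subset\mathfrak S_n$ is the Young subgroup of permutations preserving every block of $\alpha$, and $V_\lambda^{\mathfrak S_\alpha}$ is the subspace of vectors fixed by $\pi_\lambda(g)$ for all $g\in\mathfrak S_\alpha$. $\mathcal S^{\rm Y}(V_\lambda)=\{V_\lambda^{\mathfrak S_\alpha}:\alpha\in\Pi_n\}$, ordered by inclusion; this poset is a lattice (in which the meet is the intersection of subspaces, while the join need not be the sum). *)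

theory Defs
  imports
    "HOL-Algebra.Sym_Groups"
    "HOL-Algebra.Lattice"
    "HOL-Library.Disjoint_Sets"
    "HOL-Library.Function_Algebras"
    Complex_Main
begin

definition join_homomorphism ::
    "('a, 'c) gorder_scheme \<Rightarrow> ('b, 'd) gorder_scheme \<Rightarrow> ('a \<Rightarrow> 'b) \<Rightarrow> bool" where
  "join_homomorphism L M f \<longleftrightarrow>
     Lattice.lattice L \<and> Lattice.lattice M \<and> f \<in> carrier L \<rightarrow> carrier M \<and>
     (\<forall>x\<in>carrier L. \<forall>y\<in>carrier L. f (x \<squnion>\<^bsub>L\<^esub> y) = f x \<squnion>\<^bsub>M\<^esub> f y)"

definition set_partition_lattice :: "nat \<Rightarrow> nat set set gorder" where
  "set_partition_lattice n =
     \<lparr>carrier = {\<alpha>. partition_on {1..n} \<alpha>}, eq = (=), le = refines {1..n}\<rparr>"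

definition young_subgroup :: "nat \<Rightarrow> nat set set \<Rightarrow> (nat \<Rightarrow> nat) set" where
  "young_subgroup n \<alpha> = {g \<in> carrier (sym_group n). \<forall>B\<in>\<alpha>. g ` B = B}"

definition is_partition :: "nat list \<Rightarrow> nat \<Rightarrow> bool" where
  "is_partition \<mu> n \<longleftrightarrow> sorted_wrt (\<ge>) \<mu> \<and> 0 \<notin> set \<mu> \<and> sum_list \<mu> = n"

text \<open>
  The irreducible representation attached to the diagram \<open>\<mu>\<close> is realized as the Specht module,
  the complex span of the polytabloids inside the space of functions on tabloids.
  A tableau is the list of its rows, from top to bottom; a tabloid is the list of its row sets.
  For \<open>\<mu> = [n]\<close> this is the trivial representation.
\<close>

definition tableaux :: "nat list \<Rightarrow> nat list list set" where
  "tableaux \<mu> =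
     {t. map length t = \<mu> \<and> distinct (concat t) \<and> set (concat t) = {1..sum_list \<mu>}}"

definition tabloid :: "nat list list \<Rightarrow> nat set list" where
  "tabloid t = map set t"

definition column :: "nat list list \<Rightarrow> nat \<Rightarrow> nat set" where
  "column t j = {r ! j | r. r \<in> set t \<and> j < length r}"

definition column_stabilizer :: "nat list list \<Rightarrow> (nat \<Rightarrow> nat) set" where
  "column_stabilizer t = {p. p permutes set (concat t) \<and> (\<forall>j. p ` column t j = column t j)}"

definition polytabloid :: "nat list list \<Rightarrow> nat set list \<Rightarrow> complex" where
  "polytabloid t T =
     (\<Sum>p\<in>column_stabilizer t. of_int (sign p) * of_bool (T = tabloid (map (map p) t)))"

global_interpretation cfun: vector_space "\<lambda>(c::complex) (f::'a \<Rightarrow> complex) x. c * f x"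
  by unfold_locales (auto simp: fun_eq_iff algebra_simps)

definition specht_module :: "nat list \<Rightarrow> (nat set list \<Rightarrow> complex) set" where
  "specht_module \<mu> = cfun.span (polytabloid ` tableaux \<mu>)"

text \<open>
  Functions are transported along \<open>g\<close>: the indicator of a tabloid \<open>T\<close> goes to the indicator of
  \<open>g T\<close>, whence the inverse in the argument.
\<close>

definition specht_action ::
    "(nat \<Rightarrow> nat) \<Rightarrow> (nat set list \<Rightarrow> complex) \<Rightarrow> nat set list \<Rightarrow> complex" where
  "specht_action g v = (\<lambda>T. v (map (image (inv' g)) T))"

definition fixed_subspace ::
    "nat list \<Rightarrow> (nat \<Rightarrow> nat) set \<Rightarrow> (nat set list \<Rightarrow> complex) set" where
  "fixed_subspace \<mu> H = {v \<in> specht_module \<mu>. \<forall>g\<in>H. specht_action g v = v}"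

definition young_invariants_lattice ::
    "nat list \<Rightarrow> nat \<Rightarrow> (nat set list \<Rightarrow> complex) set gorder" where
  "young_invariants_lattice \<mu> n =
     \<lparr>carrier = {fixed_subspace \<mu> (young_subgroup n \<alpha>) | \<alpha>. partition_on {1..n} \<alpha>},
      eq = (=), le = (\<subseteq>)\<rparr>"

end

(* A vector v determines the relation "the transposition (a b) fixes v" on [n]. It is an equivalence
   relation, because (a c) = (a b)(b c)(a b). As a Young subgroup is generated by the transpositions
   it contains, v is fixed by the Young subgroup of \<alpha> iff \<alpha> refines the partition \<kappa>(v)
   into classes of this relation. So \<phi>(\<alpha>) = {v. \<alpha> \<le> \<kappa>(v)}, and such a map turns
   arbitrary joins into intersections. *)

theory Submission
  imports Defs
begin

section \<open>The lattice of set partitions\<close>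

lemma partial_order_set_partition_lattice: "partial_order (set_partition_lattice n)"
proof
  show "x \<sqsubseteq>\<^bsub>set_partition_lattice n\<^esub> z"
    if "x \<sqsubseteq>\<^bsub>set_partition_lattice n\<^esub> y" "y \<sqsubseteq>\<^bsub>set_partition_lattice n\<^esub> z" for x y z
    using that refines_trans[of "{1..n}" x y z] by (simp add: set_partition_lattice_def)
  show "x .=\<^bsub>set_partition_lattice n\<^esub> y"
    if "x \<sqsubseteq>\<^bsub>set_partition_lattice n\<^esub> y" "y \<sqsubseteq>\<^bsub>set_partition_lattice n\<^esub> x" for x y
    using that refines_asym[of "{1..n}" x y] by (simp add: set_partition_lattice_def)
qed (simp_all add: set_partition_lattice_def refines_refl)

text \<open>Blocks are nonempty, so the coarsest partition of the empty set has no block;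
  subtracting \<open>{{}}\<close> covers this case, which occurs for n = 0.\<close>

lemma partition_on_trivial: "partition_on A ({A} - {{}})"
  by (auto simp: partition_on_def disjoint_def)

text \<open>A top element and infima of nonempty families suffice, and the infimum is the common
  refinement. Joins then arise as infima of upper bounds.\<close>

lemma complete_lattice_set_partition_lattice: "complete_lattice (set_partition_lattice n)"
proof -
  interpret partial_order "set_partition_lattice n"
    by (rule partial_order_set_partition_lattice)
  show ?thesis
  proof (rule complete_lattice_criterion1)
    have "refines {1..n} \<alpha> ({{1..n}} - {{}})" if "partition_on {1..n} \<alpha>" for \<alpha>
      unfolding refines_def
    proof (intro conjI ballI)
      fix B assume "B \<in> \<alpha>"
      then have "B \<subseteq> {1..n}" "B \<noteq> {}"
        using that by (auto simp: partition_on_def)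
      then show "\<exists>C\<in>{{1..n}} - {{}}. B \<subseteq> C"
        by (intro bexI[of _ "{1..n}"]) auto
    qed (rule that partition_on_trivial)+
    then show "\<exists>g. greatest (set_partition_lattice n) g (carrier (set_partition_lattice n))"
      unfolding greatest_def set_partition_lattice_def gorder.simps partial_object.simps eq_object.simps
      using partition_on_trivial[of "{1..n}"] by blast
  next
    fix S assume "S \<subseteq> carrier (set_partition_lattice n)" and ne: "S \<noteq> {}"
    then have S: "\<And>\<alpha>. \<alpha> \<in> S \<Longrightarrow> partition_on {1..n} \<alpha>"
      by (auto simp: set_partition_lattice_def)
    have "greatest (set_partition_lattice n) (common_refinement S)
        (Lower (set_partition_lattice n) S)"
      using S ne partition_on_common_refinement[OF S ne]
      by (auto simp: greatest_def Lower_def set_partition_lattice_def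
          intro: refines_common_refinement common_refinement_coarsest)
    then show "\<exists>i. greatest (set_partition_lattice n) i (Lower (set_partition_lattice n) S)" ..
  qed
qed

section \<open>Young subgroups and transpositions\<close>

text \<open>\<open>H\<close> will be the stabilizer of a vector. Since
  \<open>transpose a a = id\<close>, the diagonal belongs to the relation as soon as
  \<open>id \<in> H\<close>.\<close>

definition swap_rel :: "nat \<Rightarrow> (nat \<Rightarrow> nat) set \<Rightarrow> (nat \<times> nat) set" where
  "swap_rel n H = {(a, b). a \<in> {1..n} \<and> b \<in> {1..n} \<and> transpose a b \<in> H}"

lemma equiv_swap_rel:
  assumes id: "id \<in> H" and comp: "\<And>g h. g \<in> H \<Longrightarrow> h \<in> H \<Longrightarrow> g \<circ> h \<in> H"
  shows "equiv {1..n} (swap_rel n H)"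
proof (rule equivI)
  show "swap_rel n H \<subseteq> {1..n} \<times> {1..n}" by (auto simp: swap_rel_def)
  show "refl_on {1..n} (swap_rel n H)"
    using id by (auto simp: refl_on_def swap_rel_def)
  show "sym (swap_rel n H)"
    by (auto simp: sym_def swap_rel_def transpose_commute)
  show "trans (swap_rel n H)"
  proof (rule transI)
    fix a b c assume ab: "(a, b) \<in> swap_rel n H" and bc: "(b, c) \<in> swap_rel n H"
    have "transpose a c \<in> H"
    \<comment> \<open>The conjugation identity is used for three distinct points only; for a = c
      different from b it would give (a b) instead of the identity.\<close>
    proof (cases "a = b \<or> b = c \<or> a = c")
      case True
      then show ?thesis using ab bc id by (auto simp: swap_rel_def)
    next
      case False
      then have "transpose a c = transpose a b \<circ> (transpose b c \<circ> transpose a b)"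
        by (auto simp: fun_eq_iff transpose_def)
      then show ?thesis using ab bc comp by (auto simp: swap_rel_def)
    qed
    then show "(a, c) \<in> swap_rel n H" using ab bc by (auto simp: swap_rel_def)
  qed
qed

text \<open>This is the usual factorization of a permutation into transpositions, one point of the
  support at a time, arranged so that every factor lies in \<open>H\<close>.\<close>

lemma permutes_mem_if_moves_within_swap_rel:
  assumes id: "id \<in> H" and comp: "\<And>g h. g \<in> H \<Longrightarrow> h \<in> H \<Longrightarrow> g \<circ> h \<in> H"
    and "finite S" "S \<subseteq> {1..n}" "g permutes S" "\<And>x. x \<in> S \<Longrightarrow> (x, g x) \<in> swap_rel n H"
  shows "g \<in> H"
  using assms(3-)
proof (induction S arbitrary: g rule: finite_induct)
  case empty
  then have "g = id" by simp
  with id show ?case by blast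
next
  case (insert a S)
  note eq = equiv_swap_rel[OF id comp, of n]
  \<comment> \<open>\<open>?h\<close> fixes a, so its support shrinks to \<open>S\<close>.\<close>
  let ?h = "transpose a (g a) \<circ> g"
  have h: "?h permutes S"
    using insert.prems(2) by (rule permutes_insert_lemma)
  have "(x, ?h x) \<in> swap_rel n H" if "x \<in> S" for x
  \<comment> \<open>\<open>?h x\<close> differs from \<open>g x\<close> only if
    \<open>g x = a\<close>, and then transitivity along x, a, \<open>g a\<close> applies;
    \<open>g x = g a\<close> is excluded by injectivity.\<close>
  proof (cases "g x = a")
    case True
    have "(x, a) \<in> swap_rel n H" "(a, g a) \<in> swap_rel n H"
      using insert.prems(3)[of x] insert.prems(3)[of a] True that by auto
    then show ?thesis using True eq by (auto elim!: equivE dest: transD)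
  next
    case False
    moreover have "g x \<noteq> g a"
      using insert.prems(2) insert.hyps(2) that by (metis permutes_def)
    ultimately show ?thesis using insert.prems(3)[of x] that by simp
  qed
  then have "?h \<in> H" using insert.IH h insert.prems(1) by blast
  moreover have "transpose a (g a) \<in> H"
    using insert.prems(3)[of a] by (simp add: swap_rel_def)
  ultimately have "transpose a (g a) \<circ> ?h \<in> H" using comp by blast
  then show ?case by (simp add: comp_assoc[symmetric])
qed

text \<open>From left to right, the transposition of two points of one block lies in the Young
  subgroup. Conversely, an element of the Young subgroup moves each point within its block, hence
  within a class, and so factors into transpositions from \<open>H\<close>.\<close>

lemma young_subgroup_subset_iff:
  assumes id: "id \<in> H" and comp: "\<And>g h. g \<in> H \<Longrightarrow> h \<in> H \<Longrightarrow> g \<circ> h \<in> H"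
    and \<alpha>: "partition_on {1..n} \<alpha>"
  shows "young_subgroup n \<alpha> \<subseteq> H \<longleftrightarrow> refines {1..n} \<alpha> ({1..n} // swap_rel n H)"
proof -
  note eq = equiv_swap_rel[OF id comp, of n]
  have \<kappa>: "partition_on {1..n} ({1..n} // swap_rel n H)"
    by (rule partition_on_quotient[OF eq])
  show ?thesis
  proof
    assume sub: "young_subgroup n \<alpha> \<subseteq> H"
    have "\<exists>C\<in>{1..n} // swap_rel n H. B \<subseteq> C" if B: "B \<in> \<alpha>" for B
    proof -
      have "B \<noteq> {}" using B \<alpha> by (auto simp: partition_on_def)
      then obtain a where a: "a \<in> B" by blast
      have Bn: "B \<subseteq> {1..n}" using B \<alpha> by (auto simp: partition_on_def)
      have "(a, b) \<in> swap_rel n H" if b: "b \<in> B" for b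
      proof -
        have "transpose a b ` D = D" if D: "D \<in> \<alpha>" for D
        proof -
          have "D = B \<or> D \<inter> B = {}" using D B \<alpha> by (auto simp: partition_on_def disjoint_def)
          then have "a \<in> D \<longleftrightarrow> b \<in> D" using a b by auto
          then show ?thesis by (cases "a \<in> D") (auto simp: transpose_image_eq)
        qed
        moreover have "transpose a b permutes {1..n}"
          using a b Bn by (intro permutes_swap_id) auto
        ultimately have "transpose a b \<in> young_subgroup n \<alpha>"
          by (simp add: young_subgroup_def sym_group_carrier)
        then have "transpose a b \<in> H" using sub by blast
        then show ?thesis using a b Bn by (auto simp: swap_rel_def)
      qed
      then have "B \<subseteq> swap_rel n H `` {a}" by auto
      moreover have "swap_rel n H `` {a} \<in> {1..n} // swap_rel n H"
        using a Bn by (auto intro: quotientI)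
      ultimately show ?thesis by blast
    qed
    then show "refines {1..n} \<alpha> ({1..n} // swap_rel n H)"
      using \<alpha> \<kappa> by (auto simp: refines_def)
  next
    assume ref: "refines {1..n} \<alpha> ({1..n} // swap_rel n H)"
    show "young_subgroup n \<alpha> \<subseteq> H"
    proof
      fix g assume g: "g \<in> young_subgroup n \<alpha>"
      show "g \<in> H"
      proof (rule permutes_mem_if_moves_within_swap_rel[OF id comp])
        show "g permutes {1..n}" using g by (simp add: young_subgroup_def sym_group_carrier)
        fix x assume "x \<in> {1..n}"
        moreover have "\<Union>\<alpha> = {1..n}" using \<alpha> by (rule partition_onD1[symmetric])
        ultimately obtain B where B: "B \<in> \<alpha>" "x \<in> B" by blast
        moreover from B g have "g x \<in> B" by (auto simp: young_subgroup_def)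
        moreover obtain C where "C \<in> {1..n} // swap_rel n H" "B \<subseteq> C"
          using ref B by (auto simp: refines_def)
        ultimately show "(x, g x) \<in> swap_rel n H"
          \<comment> \<open>With both classes taken to be \<open>C\<close>, the criterion says that
            two members of one class are related.\<close>
          using quotient_eq_iff[OF eq, of C C x "g x"] by blast
      qed auto
    qed
  qed
qed

section \<open>Invariants of Young subgroups\<close>

text \<open>The stabilizer is taken among bijections, where \<open>inv'\<close> reverses products
  and \<open>specht_action\<close> is thus multiplicative.\<close>

definition swap_partition :: "nat \<Rightarrow> (nat set list \<Rightarrow> complex) \<Rightarrow> nat set set" where
  "swap_partition n v = {1..n} // swap_rel n {g. bij g \<and> specht_action g v = v}"

lemma specht_action_id: "specht_action id v = v"
  by (simp add: specht_action_def fun_eq_iff)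

lemma specht_action_comp:
  assumes "bij g" "bij h"
  shows "specht_action (g \<circ> h) v = specht_action g (specht_action h v)"
  proof -
  have "(`) (inv' (g \<circ> h)) = (`) (inv' h) \<circ> (`) (inv' g)"
    by (simp only: o_inv_distrib[OF assms] fun_eq_iff image_comp comp_apply) simp
  then show ?thesis by (simp only: specht_action_def map_map)
qed

lemma
  shows id_mem_stabilizer: "id \<in> {g. bij g \<and> specht_action g v = v}"
    and comp_mem_stabilizer: "\<And>g h. g \<in> {g. bij g \<and> specht_action g v = v} \<Longrightarrow>
      h \<in> {g. bij g \<and> specht_action g v = v} \<Longrightarrow> g \<circ> h \<in> {g. bij g \<and> specht_action g v = v}"
  by (auto simp: specht_action_id specht_action_comp bij_comp)

lemma partition_on_swap_partition: "partition_on {1..n} (swap_partition n v)"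
  unfolding swap_partition_def
  by (rule partition_on_quotient[OF equiv_swap_rel[OF id_mem_stabilizer comp_mem_stabilizer]])

text \<open>A subgroup fixes v iff it is contained in the stabilizer of v, so the criterion for
  containing a Young subgroup applies with \<open>H\<close> this stabilizer.\<close>

lemma fixed_subspace_young_subgroup:
  assumes "partition_on {1..n} \<alpha>"
  shows "fixed_subspace \<mu> (young_subgroup n \<alpha>) =
    {v \<in> specht_module \<mu>. refines {1..n} \<alpha> (swap_partition n v)}"
proof -
  have "(\<forall>g\<in>young_subgroup n \<alpha>. specht_action g v = v) \<longleftrightarrow>
      young_subgroup n \<alpha> \<subseteq> {g. bij g \<and> specht_action g v = v}" for v
    by (auto simp: young_subgroup_def sym_group_carrier permutes_bij)
  then show ?thesis
    by (simp only: fixed_subspace_def swap_partition_def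
        young_subgroup_subset_iff[OF id_mem_stabilizer comp_mem_stabilizer assms])
qed

section \<open>Upper level sets of a map into a complete lattice\<close>

text \<open>An element lies above \<open>\<Squnion>S\<close> iff it lies above every member of
  \<open>S\<close>, so \<open>\<phi> (\<Squnion>S)\<close> is the intersection of the level sets,
  taken inside \<open>X\<close>. Being itself in the carrier of \<open>M\<close>, it is the infimum
  there.\<close>

lemma greatest_Lower_level_sets:
  fixes L (structure) and \<kappa> :: "'v \<Rightarrow> 'a"
  assumes "complete_lattice L" and \<kappa>: "\<And>v. v \<in> X \<Longrightarrow> \<kappa> v \<in> carrier L"
    and \<phi>: "\<And>a. a \<in> carrier L \<Longrightarrow> \<phi> a = {v \<in> X. a \<sqsubseteq> \<kappa> v}"
    and M: "carrier M = \<phi> ` carrier L" "le M = (\<subseteq>)"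
    and S: "S \<subseteq> carrier L"
  shows "greatest M (\<phi> (\<Squnion>S)) (Lower M (\<phi> ` S))"
proof -
  interpret complete_lattice L by fact
  have "\<Squnion>S \<sqsubseteq> c \<longleftrightarrow> (\<forall>a\<in>S. a \<sqsubseteq> c)" if "c \<in> carrier L" for c
    using S that by (meson le_trans subsetD sup_closed sup_least sup_upper)
  then have inf: "\<phi> (\<Squnion>S) = {v \<in> X. \<forall>a\<in>S. a \<sqsubseteq> \<kappa> v}"
    using S \<kappa> by (auto simp: \<phi>)
  show ?thesis
  proof (rule greatest_LowerI)
    show "\<phi> (\<Squnion>S) \<sqsubseteq>\<^bsub>M\<^esub> U" if "U \<in> \<phi> ` S" for U
      using that S by (auto simp: inf \<phi> M)
    show "U \<sqsubseteq>\<^bsub>M\<^esub> \<phi> (\<Squnion>S)" if U: "U \<in> Lower M (\<phi> ` S)" for U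
    proof -
      obtain u where "u \<in> carrier L" "U = \<phi> u"
        using U by (auto simp: Lower_def M)
      \<comment> \<open>This matters for empty \<open>S\<close>, where the intersection is all of
        \<open>X\<close>.\<close>
      then have "U \<subseteq> X" using \<phi> by auto
      moreover have "U \<subseteq> \<phi> a" if "a \<in> S" for a
        using U that S by (auto simp: Lower_def M)
      moreover have "\<phi> a = {v \<in> X. a \<sqsubseteq> \<kappa> v}" if "a \<in> S" for a
        using that S \<phi> by blast
      ultimately show ?thesis
        unfolding inf M by blast
    qed
  qed (use S M in auto)
qed

text \<open>Every family in \<open>M\<close> is the image of a subset of \<open>L\<close>, so all
  infima exist in \<open>M\<close>. Joins in the dual are these infima.\<close>

lemma join_homomorphism_level_sets:
  fixes L (structure) and \<kappa> :: "'v \<Rightarrow> 'a"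
  assumes L: "complete_lattice L" and \<kappa>: "\<And>v. v \<in> X \<Longrightarrow> \<kappa> v \<in> carrier L"
    and \<phi>: "\<And>a. a \<in> carrier L \<Longrightarrow> \<phi> a = {v \<in> X. a \<sqsubseteq> \<kappa> v}"
  defines "M \<equiv> \<lparr>carrier = \<phi> ` carrier L, eq = (=), le = (\<subseteq>)\<rparr>"
  shows "join_homomorphism L (inv_gorder M) \<phi>"
proof -
  interpret complete_lattice L by fact
  interpret M: partial_order M by unfold_locales (auto simp: M_def)
  have inf: "greatest M (\<phi> (\<Squnion>S)) (Lower M (\<phi> ` S))" if "S \<subseteq> carrier L" for S
    by (rule greatest_Lower_level_sets[OF L \<kappa> \<phi> _ _ that]) (auto simp: M_def)
  have infM: "\<exists>i. greatest M i (Lower M A)" if A: "A \<subseteq> carrier M" for A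
  proof -
    obtain S where "S \<subseteq> carrier L" "A = \<phi> ` S"
      using A by (auto simp: M_def subset_image_iff)
    with inf show ?thesis by blast
  qed
  have "complete_lattice M"
  proof (rule M.complete_lattice_criterion1)
    show "\<exists>g. greatest M g (carrier M)"
      \<comment> \<open>Every element is a lower bound of the empty family, so its infimum is the
        top.\<close>
      using infM[of "{}"] by (simp add: Lower_def)
  qed (rule infM)
  then interpret M: complete_lattice M .
  \<comment> \<open>Both sides are greatest lower bounds of the same pair.\<close>
  have "\<phi> (x \<squnion> y) = \<phi> x \<sqinter>\<^bsub>M\<^esub> \<phi> y" if xy: "x \<in> carrier L" "y \<in> carrier L" for x y
  proof -
    have "greatest M (\<phi> (x \<squnion> y)) (Lower M {\<phi> x, \<phi> y})"
      using inf[of "{x, y}"] xy by (simp add: join_def)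
    moreover have "greatest M (\<phi> x \<sqinter>\<^bsub>M\<^esub> \<phi> y) (Lower M {\<phi> x, \<phi> y})"
      unfolding meet_def using xy by (intro M.inf_glb) (auto simp: M_def)
    ultimately show ?thesis by (rule M.greatest_unique)
  qed
  moreover have "\<phi> \<in> carrier L \<rightarrow> carrier (inv_gorder M)"
    by (auto simp: M_def)
  ultimately show ?thesis
    using lattice_axioms M.dual_lattice unfolding join_homomorphism_def join_dual by blast
qed

theorem theorem4:
  fixes n :: nat and \<mu> :: "nat list"
  assumes "is_partition \<mu> n"
  shows "join_homomorphism (set_partition_lattice n) (inv_gorder (young_invariants_lattice \<mu> n))
           (\<lambda>\<alpha>. fixed_subspace \<mu> (young_subgroup n \<alpha>))"
proof -
  \<comment> \<open>The carrier is rewritten as an image of the partition lattice, the shape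
    required by the result on level sets.\<close>
  have "young_invariants_lattice \<mu> n =
      \<lparr>carrier = (\<lambda>\<alpha>. fixed_subspace \<mu> (young_subgroup n \<alpha>)) ` carrier (set_partition_lattice n),
        eq = (=), le = (\<subseteq>)\<rparr>"
    by (auto simp: young_invariants_lattice_def set_partition_lattice_def)
  moreover have "join_homomorphism (set_partition_lattice n)
      (inv_gorder \<lparr>carrier = (\<lambda>\<alpha>. fixed_subspace \<mu> (young_subgroup n \<alpha>)) ` carrier (set_partition_lattice n),
        eq = (=), le = (\<subseteq>)\<rparr>) (\<lambda>\<alpha>. fixed_subspace \<mu> (young_subgroup n \<alpha>))"
    by (rule join_homomorphism_level_sets[where X = "specht_module \<mu>" and \<kappa> = "swap_partition n"])
      (use complete_lattice_set_partition_lattice partition_on_swap_partition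
        fixed_subspace_young_subgroup in \<open>auto simp: set_partition_lattice_def\<close>)
  ultimately show ?thesis by simp
qed

end
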